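(* Let $n$ and $k$ be integers with $1\le k\le n-1$, and let $G$ be a connected graph with $n$ vertices and edge connectivity $\kappa'(G)\le k$. Then $$SO(G)\geq 2\sqrt{2}(n-3)+2\sqrt{5},$$ with equality if and only if $G\cong P_{n}$.
   Context: All graphs are finite, simple and undirected. For a graph $G$ with edge set $E(G)$, $d(u)$ denotes the degree of vertex $u$, and the Sombor index is $SO(G)=\sum_{uv\in E(G)}\sqrt{d(u)^{2}+d(v)^{2}}$. $\kappa'(G)$ is the usual edge connectivity of $G$: the largest $k\ge 1$ such that $G$ (connected, with at least 2 vertices) cannot be disconnected by deleting fewer than $k$ edges. $P_n$ denotes the path with $n$ vertices.
   Formalization: The formal theorem assumes n ≥ 3; the statement fails for n = 2, k = 1, where the only connected graph is K_2 = P_2 with SO = √2 ≈ 1.414, below the claimed bound 2√5 − 2√2 ≈ 1.644. *)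

theory Defs
  imports Complex_Main
begin

text \<open>A graph is given by its vertex set \<open>V\<close> and its edge set \<open>E\<close>, whose members are
  two-element subsets of \<open>V\<close>.\<close>

definition simple_graph :: "'a set \<Rightarrow> 'a set set \<Rightarrow> bool" where
  "simple_graph V E \<longleftrightarrow> finite V \<and> (\<forall>e\<in>E. e \<subseteq> V \<and> card e = 2)"

definition degree :: "'a set set \<Rightarrow> 'a \<Rightarrow> nat" where
  "degree E v = card {e \<in> E. v \<in> e}"

definition connected_graph :: "'a set \<Rightarrow> 'a set set \<Rightarrow> bool" where
  "connected_graph V E \<longleftrightarrow>
     V \<noteq> {} \<and> (\<forall>u\<in>V. \<forall>v\<in>V. (u, v) \<in> {(x, y). {x, y} \<in> E}\<^sup>*)"

text \<open>Meaningful for connected graphs with at least two vertices: only then do the numbers \<open>k\<close>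
  below form a nonempty bounded set.\<close>

definition edge_connectivity :: "'a set \<Rightarrow> 'a set set \<Rightarrow> nat" where
  "edge_connectivity V E =
     (GREATEST k. 1 \<le> k \<and> (\<forall>F\<subseteq>E. card F < k \<longrightarrow> connected_graph V (E - F)))"

text \<open>The two endpoints of an edge \<open>e\<close> are its elements, so the sum over \<open>v \<in> e\<close> is
  \<open>d(u)\<^sup>2 + d(v)\<^sup>2\<close> for \<open>e = {u, v}\<close>.\<close>

definition sombor_index :: "'a set set \<Rightarrow> real" where
  "sombor_index E = (\<Sum>e\<in>E. sqrt (\<Sum>v\<in>e. (real (degree E v))\<^sup>2))"

definition path_verts :: "nat \<Rightarrow> nat set" where
  "path_verts n = {..<n}"

definition path_edges :: "nat \<Rightarrow> nat set set" where
  "path_edges n = {{i, Suc i} | i. Suc i < n}"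

definition graph_iso :: "'a set \<Rightarrow> 'a set set \<Rightarrow> 'b set \<Rightarrow> 'b set set \<Rightarrow> bool" where
  "graph_iso V E V' E' \<longleftrightarrow>
     (\<exists>f. bij_betw f V V' \<and> (\<forall>u\<in>V. \<forall>v\<in>V. {u, v} \<in> E \<longleftrightarrow> {f u, f v} \<in> E'))"

end

theory Submission
  imports Defs
begin

text \<open>Put \<open>\<alpha> = 3\<surd>2 - \<surd>5\<close> and \<open>\<beta> = 2\<surd>5 - 4\<surd>2 < 0\<close>. For positive integers \<open>a\<close>, \<open>b\<close>, not both \<open>1\<close>,
  \<open>\<surd>(a\<^sup>2 + b\<^sup>2) \<ge> 2\<alpha> + \<beta>/a + \<beta>/b\<close>, with equality iff \<open>a, b \<le> 2\<close>. In a connected graph with \<open>n \<ge> 3\<close>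
  vertices and \<open>m\<close> edges no edge joins two leaves, and the sum of \<open>1/d(u) + 1/d(v)\<close> over the edges
  is \<open>n\<close>. Hence \<open>SO(G) \<ge> 2\<alpha>m + \<beta>n \<ge> 2\<alpha>(n - 1) + \<beta>n = 2\<surd>2(n - 3) + 2\<surd>5\<close>. Equality forces a tree
  of maximum degree at most \<open>2\<close>, which is a path.\<close>

section \<open>The inequality for a single edge\<close>

definition path_slope :: real where
  "path_slope = 3 * sqrt 2 - sqrt 5"

text \<open>\<open>path_slope\<close> and \<open>path_defect\<close> are the \<alpha> and \<beta>
  that solve 2\<alpha> + \<beta> = sqrt 8 and 2\<alpha> + 3\<beta>/2 = sqrt 5. These make the edge
  inequality tight at the degree pairs (2, 2) and (1, 2), the only ones in a path with at least
  three vertices.\<close>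

definition path_defect :: real where
  "path_defect = 2 * sqrt 5 - 4 * sqrt 2"

lemma sqrt_multiples:
  "sqrt 8 = 2 * sqrt 2" "sqrt 18 = 3 * sqrt 2" "sqrt 20 = 2 * sqrt 5"
  using real_sqrt_mult[of 4 2] real_sqrt_mult[of 9 2] real_sqrt_mult[of 4 5] by simp_all

lemma path_slope_pos: "path_slope > 0"
proof -
  have "sqrt 5 < sqrt 18" by simp
  then show ?thesis unfolding path_slope_def sqrt_multiples by linarith
qed

lemma path_defect_neg: "path_defect < 0"
proof -
  have "sqrt 5 < sqrt 8" by simp
  then show ?thesis unfolding path_defect_def sqrt_multiples by linarith
qed

text \<open>Both fractions are negative and 2\<alpha> = 2 sqrt 18 - sqrt 20 < sqrt 18, which settles
  every pair with a^2 + b^2 at least 18. Two kinds of pairs need their own argument: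
  \<open>a = 1\<close>, where the left side stays below 2\<alpha> + \<beta> = sqrt 8, and (2,
  3).\<close>

lemma sqrt_sum_squares_gt:
  fixes a b :: nat
  assumes "1 \<le> a" "a \<le> b" "3 \<le> b"
  shows "2 * path_slope + path_defect / real a + path_defect / real b
    < sqrt ((real a)\<^sup>2 + (real b)\<^sup>2)"
proof -
  have neg: "path_defect / real j < 0" if "1 \<le> j" for j
    using that path_defect_neg by (simp add: divide_neg_pos)
  have negs: "path_defect / real a < 0" "path_defect / real b < 0"
    using neg assms by auto
  have "sqrt 18 < sqrt 20" by simp
  then have slope: "2 * path_slope < sqrt 18"
    unfolding path_slope_def sqrt_multiples by (simp add: algebra_simps)
  have large: ?thesis if "18 \<le> (real a)\<^sup>2 + (real b)\<^sup>2"
  proof -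
    have "2 * path_slope < sqrt ((real a)\<^sup>2 + (real b)\<^sup>2)"
      using slope real_sqrt_le_mono[OF that] by (rule less_le_trans)
    then show ?thesis using negs by linarith
  qed
  consider "a = 1" | "a = 2" "b = 3" | "2 \<le> a" "4 \<le> b" | "3 \<le> a"
    using assms by linarith
  then show ?thesis
  proof cases
    case 1
    have "3\<^sup>2 \<le> (real b)\<^sup>2" using assms by (intro power_mono) auto
    then have "sqrt 8 < sqrt (1 + (real b)\<^sup>2)"
      by (intro real_sqrt_less_mono) simp
    moreover have "2 * path_slope + path_defect = sqrt 8"
      by (simp add: path_slope_def path_defect_def sqrt_multiples)
    ultimately show ?thesis using 1 negs(2) by (simp del: real_sqrt_less_iff)
  next
    case 2
    \<comment> \<open>For (2, 3) the claim reads (8 sqrt 2 - sqrt 5) / 3 < sqrt 13. The rational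
      bounds put the left side below 3.1 and the right side above 3.5.\<close>
    have "11 / 5 < sqrt 5" "7 / 2 < sqrt 13"
      by (rule real_less_rsqrt; simp add: power2_eq_square)+
    moreover have "sqrt 2 < 71 / 50" by (rule real_less_lsqrt) (simp_all add: power2_eq_square)
    ultimately show ?thesis
      using 2 by (simp add: path_slope_def path_defect_def field_simps)
  next
    case 3
    have "2\<^sup>2 \<le> (real a)\<^sup>2" "4\<^sup>2 \<le> (real b)\<^sup>2" using 3 by (intro power_mono; simp)+
    then have "18 \<le> (real a)\<^sup>2 + (real b)\<^sup>2" by simp
    then show ?thesis by (rule large)
  next
    case 4
    have "3\<^sup>2 \<le> (real a)\<^sup>2" "3\<^sup>2 \<le> (real b)\<^sup>2" using 4 assms by (intro power_mono; simp)+
    then have "18 \<le> (real a)\<^sup>2 + (real b)\<^sup>2" by simp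
    then show ?thesis by (rule large)
  qed
qed

lemma sqrt_sum_squares_eq:
  fixes a b :: nat
  assumes "1 \<le> a" "1 \<le> b" "\<not> (a = 1 \<and> b = 1)" "a \<le> 2" "b \<le> 2"
  shows "sqrt ((real a)\<^sup>2 + (real b)\<^sup>2)
    = 2 * path_slope + path_defect / real a + path_defect / real b"
proof -
  consider "a = 1" "b = 2" | "a = 2" "b = 1" | "a = 2" "b = 2"
    using assms by linarith
  then show ?thesis
    by cases (simp_all add: path_slope_def path_defect_def sqrt_multiples field_simps)
qed

lemma sqrt_sum_squares_bound:
  fixes a b :: nat
  assumes "1 \<le> a" "1 \<le> b" "\<not> (a = 1 \<and> b = 1)"
  shows "2 * path_slope + path_defect / real a + path_defect / real b
      \<le> sqrt ((real a)\<^sup>2 + (real b)\<^sup>2)"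
    and "sqrt ((real a)\<^sup>2 + (real b)\<^sup>2)
      = 2 * path_slope + path_defect / real a + path_defect / real b \<longleftrightarrow> a \<le> 2 \<and> b \<le> 2"
proof -
  have gt: "2 * path_slope + path_defect / real a + path_defect / real b
      < sqrt ((real a)\<^sup>2 + (real b)\<^sup>2)" if "\<not> (a \<le> 2 \<and> b \<le> 2)"
    using that assms sqrt_sum_squares_gt[of a b] sqrt_sum_squares_gt[of b a]
    by (cases "a \<le> b") (auto simp: add_ac)
  show "2 * path_slope + path_defect / real a + path_defect / real b
      \<le> sqrt ((real a)\<^sup>2 + (real b)\<^sup>2)"
    using gt sqrt_sum_squares_eq[of a b] assms by fastforce
  show "sqrt ((real a)\<^sup>2 + (real b)\<^sup>2)
      = 2 * path_slope + path_defect / real a + path_defect / real b \<longleftrightarrow> a \<le> 2 \<and> b \<le> 2"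
    using gt sqrt_sum_squares_eq[of a b] assms by fastforce
qed

section \<open>Incidences and connectivity in simple graphs\<close>

lemma simple_graph_finite_edges:
  assumes "simple_graph V E"
  shows "finite E"
  using assms by (auto simp: simple_graph_def intro: finite_subset[of E "Pow V"])

lemma simple_graph_edge:
  assumes "simple_graph V E" "e \<in> E"
  obtains u v where "e = {u, v}" "u \<noteq> v" "u \<in> V" "v \<in> V"
  using assms by (auto simp: simple_graph_def card_2_iff)

lemma simple_graph_incident_edge:
  assumes "simple_graph V E" "e \<in> E" "v \<in> e"
  obtains w where "e = {v, w}" "w \<noteq> v" "w \<in> V"
proof -
  obtain x y where "e = {x, y}" "x \<noteq> y" "x \<in> V" "y \<in> V"
    using simple_graph_edge[OF assms(1,2)] .
  then show ?thesis using that[of x] that[of y] assms(3) by (auto simp: insert_commute)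
qed

lemma simple_graph_edgeD:
  assumes "simple_graph V E" "{u, v} \<in> E"
  shows "u \<noteq> v" "u \<in> V" "v \<in> V"
  using assms by (auto simp: simple_graph_def)

text \<open>Double counting: a vertex is an end of as many edges as its degree. With
  \<open>g\<close> equal to \<beta> / d(v) every vertex of positive degree contributes \<beta>; with
  \<open>g\<close> constantly 1 over the naturals this is the handshake identity.\<close>

lemma sum_over_edge_ends:
  fixes g :: "'a \<Rightarrow> 'b::semiring_1"
  assumes "simple_graph V E"
  shows "(\<Sum>e\<in>E. \<Sum>v\<in>e. g v) = (\<Sum>v\<in>V. of_nat (degree E v) * g v)"
proof -
  have "(\<Sum>e\<in>E. \<Sum>v\<in>e. g v) = (\<Sum>e\<in>E. \<Sum>v | v \<in> V \<and> v \<in> e. g v)"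
    using assms by (intro sum.cong) (auto simp: simple_graph_def)
  also have "\<dots> = (\<Sum>v\<in>V. \<Sum>e | e \<in> E \<and> v \<in> e. g v)"
    using assms simple_graph_finite_edges
    by (intro sum.swap_restrict) (auto simp: simple_graph_def)
  finally show ?thesis by (simp add: degree_def)
qed

text \<open>A walk from inside \<open>S\<close> to outside must cross the boundary at some step.
  Connectivity enters the degree and edge counts below in this form.\<close>

lemma connected_graph_leaving_edge:
  assumes "connected_graph V E" "S \<subseteq> V" "S \<noteq> {}" "S \<noteq> V"
  obtains x y where "x \<in> S" "y \<notin> S" "{x, y} \<in> E"
proof -
  obtain a b where ab: "a \<in> S" "b \<in> V" "b \<notin> S" using assms by blast
  have "(a, b) \<in> {(x, y). {x, y} \<in> E}\<^sup>*"
    using assms ab by (auto simp: connected_graph_def)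
  then have "b \<in> S \<or> (\<exists>x y. x \<in> S \<and> y \<notin> S \<and> {x, y} \<in> E)"
    by (induction rule: rtrancl_induct) (use ab in auto)
  with ab that show ?thesis by blast
qed

lemma connected_graph_degree_pos:
  assumes "simple_graph V E" "connected_graph V E" "2 \<le> card V" "v \<in> V"
  shows "1 \<le> degree E v"
proof -
  have "{v} \<noteq> V" using assms by auto
  then obtain y where "{v, y} \<in> E"
    using connected_graph_leaving_edge[of V E "{v}"] assms by auto
  then show ?thesis
    using simple_graph_finite_edges[OF assms(1)] by (auto simp: degree_def Suc_le_eq card_gt_0_iff)
qed

text \<open>With a third vertex present, some edge leaves the set of the two ends, and the end it
  starts from then has degree at least 2.\<close>

lemma connected_graph_no_leaf_edge:
  assumes "simple_graph V E" "connected_graph V E" "3 \<le> card V" "{u, v} \<in> E"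
  shows "\<not> (degree E u = 1 \<and> degree E v = 1)"
proof
  assume leaves: "degree E u = 1 \<and> degree E v = 1"
  note uv = simple_graph_edgeD[OF assms(1,4)]
  have "card {u, v} = 2" using uv by simp
  then have "{u, v} \<noteq> V" using assms(3) by auto
  then obtain x y where xy: "x \<in> {u, v}" "y \<notin> {u, v}" "{x, y} \<in> E"
    using connected_graph_leaving_edge[of V E "{u, v}"] assms(2) uv by auto
  have "{{u, v}, {x, y}} \<subseteq> {e \<in> E. x \<in> e}" using xy assms(4) by auto
  moreover have "{u, v} \<noteq> {x, y}" using xy by auto
  ultimately have "2 \<le> degree E x"
    using card_mono[of "{e \<in> E. x \<in> e}" "{{u, v}, {x, y}}"]
      simple_graph_finite_edges[OF assms(1)] by (simp add: degree_def)
  with xy leaves show False by auto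
qed

text \<open>Grow a vertex set from a single vertex along leaving edges: each new vertex brings at
  least one new edge inside the set.\<close>

lemma connected_graph_card_edges:
  assumes "simple_graph V E" "connected_graph V E"
  shows "card V \<le> card E + 1"
proof -
  have finV: "finite V" and finE: "finite E"
    using assms(1) simple_graph_finite_edges by (auto simp: simple_graph_def)
  have "\<exists>S\<subseteq>V. card S = Suc j \<and> j \<le> card {e \<in> E. e \<subseteq> S}" if "Suc j \<le> card V" for j
    using that
  proof (induction j)
    case 0
    obtain v where "v \<in> V" using assms(2) by (auto simp: connected_graph_def)
    then show ?case by (intro exI[of _ "{v}"]) auto
  next
    case (Suc j)
    then obtain S where S: "S \<subseteq> V" "card S = Suc j" "j \<le> card {e \<in> E. e \<subseteq> S}" by auto
    have "S \<noteq> {}" "S \<noteq> V" using S(2) Suc.prems by auto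
    then obtain x y where xy: "x \<in> S" "y \<notin> S" "{x, y} \<in> E"
      using connected_graph_leaving_edge assms(2) S(1) by metis
    have "insert {x, y} {e \<in> E. e \<subseteq> S} \<subseteq> {e \<in> E. e \<subseteq> insert y S}" using xy by auto
    then have "card (insert {x, y} {e \<in> E. e \<subseteq> S}) \<le> card {e \<in> E. e \<subseteq> insert y S}"
      using finE by (intro card_mono) auto
    moreover have "card (insert {x, y} {e \<in> E. e \<subseteq> S}) = Suc (card {e \<in> E. e \<subseteq> S})"
      using xy finE by (subst card_insert_disjoint) auto
    moreover have "card (insert y S) = Suc (Suc j)"
      using S xy finite_subset[OF S(1) finV] by simp
    moreover have "insert y S \<subseteq> V"
      using S(1) simple_graph_edgeD[OF assms(1) xy(3)] by simp
    ultimately show ?case using S(3) by (intro exI[of _ "insert y S"]) auto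
  qed
  from this[of "card V - 1"] obtain S where "card V - 1 \<le> card {e \<in> E. e \<subseteq> S}"
    using assms(2) finV by (auto simp: connected_graph_def Suc_le_eq card_gt_0_iff)
  also have "\<dots> \<le> card E" using finE by (intro card_mono) auto
  finally show ?thesis by simp
qed

section \<open>Recognising paths\<close>

lemma path_edges_iff:
  "{i, j} \<in> path_edges n \<longleftrightarrow> (j = Suc i \<and> j < n) \<or> (i = Suc j \<and> i < n)"
  by (auto simp: path_edges_def doubleton_eq_iff)

text \<open>A walk enters and leaves \<open>v\<close> only through \<open>w\<close>, so each visit
  to \<open>v\<close> can be cut out.\<close>

lemma connected_graph_remove_leaf:
  assumes conn: "connected_graph V E"
    and leaf: "\<And>x. {v, x} \<in> E \<longleftrightarrow> x = w" and w: "w \<in> V" "w \<noteq> v"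
  shows "connected_graph (V - {v}) {e \<in> E. v \<notin> e}"
proof -
  let ?R = "{(x, y). {x, y} \<in> {e \<in> E. v \<notin> e}}"
  \<comment> \<open>Reading \<open>v\<close> as \<open>w\<close> makes the claim inductive: a step
    between \<open>v\<close> and \<open>w\<close> becomes no step at all.\<close>
  have reach: "(x, if y = v then w else y) \<in> ?R\<^sup>*"
    if "(x, y) \<in> {(x, y). {x, y} \<in> E}\<^sup>*" "x \<noteq> v" for x y
    using that(1)
  proof (induction rule: rtrancl_induct)
    case base
    then show ?case using that(2) by simp
  next
    case (step y z)
    then have yz: "{y, z} \<in> E" by simp
    consider "y = v" | "z = v" "y \<noteq> v" | "y \<noteq> v" "z \<noteq> v" by blast
    then show ?case
    proof cases
      case 1
      then have "z = w" using yz leaf by simp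
      then show ?thesis using 1 step.IH w by simp
    next
      case 2
      then have "y = w" using yz leaf[of y] by (simp add: insert_commute)
      then show ?thesis using 2 step.IH by simp
    next
      case 3
      then have "(y, z) \<in> ?R" using yz by auto
      then show ?thesis using 3 step.IH by (auto intro: rtrancl_into_rtrancl)
    qed
  qed
  have "(x, y) \<in> ?R\<^sup>*" if "x \<in> V - {v}" "y \<in> V - {v}" for x y
  proof -
    have "(x, y) \<in> {(x, y). {x, y} \<in> E}\<^sup>*"
      using conn that unfolding connected_graph_def by blast
    from reach[OF this] that show ?thesis by simp
  qed
  moreover have "V - {v} \<noteq> {}" using w by blast
  ultimately show ?thesis unfolding connected_graph_def by blast
qed

text \<open>Induction on the number of vertices: deleting the end \<open>v\<close> makes its
  neighbour \<open>w\<close> an end of the rest. Fixing \<open>f v\<close> as the last position lets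
  the deleted vertex be appended next to \<open>w\<close>. The bound
  \<open>degree E v \<le> 1\<close> admits the one-vertex graph.\<close>

lemma connected_max_degree_2_leaf_path:
  assumes "simple_graph V E" "connected_graph V E" "\<forall>u\<in>V. degree E u \<le> 2"
    and "v \<in> V" "degree E v \<le> 1"
  shows "\<exists>f. bij_betw f V {..<card V} \<and> f v = card V - 1
    \<and> (\<forall>u\<in>V. \<forall>x\<in>V. {u, x} \<in> E \<longleftrightarrow> {f u, f x} \<in> path_edges (card V))"
  using assms
proof (induction "card V" arbitrary: V E v rule: less_induct)
  case less
  note sg = less.prems(1) and conn = less.prems(2) and vV = less.prems(4)
  have finV: "finite V" and finE: "finite E"
    using sg simple_graph_finite_edges by (auto simp: simple_graph_def)
  have cV: "card V \<noteq> 0" using vV finV by auto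
  show ?case
  proof (cases "card V = 1")
    case True
    then have V: "V = {v}" using vV by (auto simp: card_1_singleton_iff)
    moreover have "{v, v} \<notin> E" using simple_graph_edgeD(1)[OF sg, of v v] by blast
    moreover have "{0, 0} \<notin> path_edges 1" by (simp only: path_edges_iff) simp
    ultimately show ?thesis
      by (intro exI[of _ "\<lambda>_. 0"]) (simp add: bij_betw_def lessThan_Suc)
  next
    case False
    define m where "m = card V - 1"
    have m: "card V = Suc m" "1 \<le> m" using False cV by (auto simp: m_def)
    have "degree E v = 1"
      using connected_graph_degree_pos[OF sg conn _ vV] less.prems(5) m by simp
    then obtain e where e: "{e \<in> E. v \<in> e} = {e}"
      by (auto simp: degree_def card_1_singleton_iff)
    then have eE: "e \<in> E" "v \<in> e" by auto
    obtain w where w: "e = {v, w}" "w \<noteq> v" "w \<in> V"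
      using simple_graph_incident_edge[OF sg eE] .
    have leaf: "{v, x} \<in> E \<longleftrightarrow> x = w" for x
    proof
      assume "{v, x} \<in> E"
      then have "{v, x} \<in> {e \<in> E. v \<in> e}" by simp
      then have "{v, x} = {v, w}" unfolding e w(1) by simp
      then show "x = w" by (auto simp: doubleton_eq_iff)
    qed (use eE w in simp)
    define E' where "E' = {e \<in> E. v \<notin> e}"
    define V' where "V' = V - {v}"
    have cV': "card V' = m" using m vV finV by (simp add: V'_def)
    have sg': "simple_graph V' E'" using sg by (auto simp: simple_graph_def V'_def E'_def)
    have conn': "connected_graph V' E'"
      using connected_graph_remove_leaf[OF conn leaf] w by (simp add: V'_def E'_def)
    have deg_le: "degree E' u \<le> degree E u" for u
      using finE by (auto simp: degree_def E'_def intro: card_mono)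
    \<comment> \<open>The deleted edge \<open>e\<close> is lost at \<open>w\<close>, so the degree
      of \<open>w\<close> drops from at most 2 to at most 1.\<close>
    have "e \<in> {e \<in> E. w \<in> e} - {e \<in> E'. w \<in> e}" using eE w(1) by (simp add: E'_def)
    moreover have "{e \<in> E'. w \<in> e} \<subseteq> {e \<in> E. w \<in> e}" by (auto simp: E'_def)
    ultimately have "{e \<in> E'. w \<in> e} \<subset> {e \<in> E. w \<in> e}" by blast
    moreover have "finite {e \<in> E. w \<in> e}" using finE by simp
    ultimately have "degree E' w < degree E w"
      unfolding degree_def by (intro psubset_card_mono)
    then have "degree E' w \<le> 1" using less.prems(3)[rule_format, OF w(3)] by linarith
    moreover have "degree E' u \<le> 2" if "u \<in> V'" for u
      using less.prems(3)[rule_format, of u] deg_le[of u] that by (simp add: V'_def)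
    moreover have "w \<in> V'" using w by (simp add: V'_def)
    ultimately obtain f where f: "bij_betw f V' {..<m}" "f w = m - 1"
      "\<And>u x. u \<in> V' \<Longrightarrow> x \<in> V' \<Longrightarrow> {u, x} \<in> E' \<longleftrightarrow> {f u, f x} \<in> path_edges m"
      using less.hyps[of V' E' w] sg' conn' cV' m by auto
    have less_m: "f x < m" if "x \<in> V'" for x using f(1) that by (auto simp: bij_betw_def)
    have inj: "f x = m - 1 \<longleftrightarrow> x = w" if "x \<in> V'" for x
      using f(1,2) that \<open>w \<in> V'\<close> by (auto simp: bij_betw_def inj_on_def)
    let ?g = "f(v := m)"
    have "bij_betw ?g V {..<card V}"
    proof -
      have "bij_betw ?g V' {..<m}"
        using f(1) by (rule bij_betw_cong[THEN iffD1, rotated]) (auto simp: V'_def)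
      then have "bij_betw ?g (V' \<union> {v}) ({..<m} \<union> {m})"
        by (intro bij_betw_combine) auto
      moreover have "V' \<union> {v} = V" using vV by (auto simp: V'_def)
      moreover have "{..<m} \<union> {m} = {..<card V}" using m by auto
      ultimately show ?thesis by simp
    qed
    moreover have "{u, x} \<in> E \<longleftrightarrow> {?g u, ?g x} \<in> path_edges (card V)"
      if uxV: "u \<in> V" "x \<in> V" for u x
    proof -
      \<comment> \<open>In the longer path the last position \<open>m\<close> is adjacent only to
        \<open>m - 1\<close>, which \<open>w\<close> alone occupies.\<close>
      have end_iff: "{v, x} \<in> E \<longleftrightarrow> {m, f x} \<in> path_edges (Suc m)" if "x \<in> V'" for x
        unfolding leaf path_edges_iff inj[OF that, symmetric] using less_m[OF that] m(2) by linarith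
      consider "u = v" "x = v" | "u = v" "x \<in> V'" | "u \<in> V'" "x = v" | "u \<in> V'" "x \<in> V'"
        using uxV unfolding V'_def by blast
      then show ?thesis
      proof cases
        case 1
        moreover have "{v, v} \<notin> E" using simple_graph_edgeD(1)[OF sg, of v v] by blast
        moreover have "{m, m} \<notin> path_edges (card V)" unfolding path_edges_iff by simp
        ultimately show ?thesis by simp
      next
        case 2
        then show ?thesis using end_iff[of x] m(1) by (simp add: V'_def)
      next
        case 3
        then show ?thesis using end_iff[of u] m(1) by (simp add: V'_def insert_commute)
      next
        case 4
        then have "u \<noteq> v" "x \<noteq> v" by (auto simp: V'_def)
        moreover from this have "{u, x} \<in> E \<longleftrightarrow> {u, x} \<in> E'" by (auto simp: E'_def)
        \<comment> \<open>Both positions lie below \<open>m\<close>, where the paths on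
          \<open>m\<close> and \<open>Suc m\<close> vertices have the same edges.\<close>
        ultimately show ?thesis
          using f(3)[OF 4] less_m[OF 4(1)] less_m[OF 4(2)] m(1) by (simp add: path_edges_iff)
      qed
    qed
    ultimately show ?thesis using m by (intro exI[of _ ?g]) auto
  qed
qed

text \<open>The degrees sum to 2 |E| = 2 (|V| - 1) < 2 |V|, so some vertex has degree at most 1 and
  can start the preceding construction.\<close>

lemma tree_max_degree_2_iso_path:
  assumes "simple_graph V E" "connected_graph V E" "\<forall>u\<in>V. degree E u \<le> 2"
    and "card V = card E + 1"
  shows "graph_iso V E (path_verts (card V)) (path_edges (card V))"
proof -
  have "\<exists>v\<in>V. degree E v \<le> 1"
  proof (rule ccontr)
    assume "\<not> ?thesis"
    then have "(\<Sum>v\<in>V. 2) \<le> (\<Sum>v\<in>V. degree E v)" by (intro sum_mono) force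
    also have "\<dots> = (\<Sum>e\<in>E. \<Sum>v\<in>e. 1)"
      using sum_over_edge_ends[OF assms(1), of "\<lambda>_. 1 :: nat"] by simp
    also have "\<dots> = (\<Sum>e\<in>E. 2)"
      using assms(1) by (intro sum.cong) (auto simp: simple_graph_def)
    finally show False using assms(4) by simp
  qed
  then show ?thesis
    using connected_max_degree_2_leaf_path[OF assms(1,2,3)]
    unfolding graph_iso_def path_verts_def by blast
qed

text \<open>Pulling positions back along the inverse of the isomorphism bounds both counts from
  above; the matching lower bound on the number of edges comes from connectivity.\<close>

lemma iso_path_card_edges_and_degree:
  assumes "simple_graph V E" "graph_iso V E (path_verts n) (path_edges n)"
  shows "card E \<le> n - 1" and "\<And>v. v \<in> V \<Longrightarrow> degree E v \<le> 2"
proof -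
  obtain f where f: "bij_betw f V {..<n}"
    "\<And>u x. u \<in> V \<Longrightarrow> x \<in> V \<Longrightarrow> {u, x} \<in> E \<longleftrightarrow> {f u, f x} \<in> path_edges n"
    using assms(2) by (auto simp: graph_iso_def path_verts_def)
  define g where "g = inv_into V f"
  have gf: "g (f u) = u" if "u \<in> V" for u
    using f(1) that by (auto simp: g_def bij_betw_def)
  have step: "(f x = Suc (f u) \<or> f u = Suc (f x)) \<and> f u < n \<and> f x < n" if "{u, x} \<in> E" for u x
    using f(2) that simple_graph_edgeD[OF assms(1) that] by (auto simp: path_edges_iff)
  have "E \<subseteq> (\<lambda>i. {g i, g (Suc i)}) ` {..<n - 1}"
  proof
    fix e assume "e \<in> E"
    then obtain u x where ux: "e = {u, x}" "u \<in> V" "x \<in> V"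
      using simple_graph_edge[OF assms(1)] by metis
    then consider "f x = Suc (f u)" "f x < n" | "f u = Suc (f x)" "f u < n"
      using step \<open>e \<in> E\<close> by blast
    then show "e \<in> (\<lambda>i. {g i, g (Suc i)}) ` {..<n - 1}"
    proof cases
      case 1
      then have "e = {g (f u), g (Suc (f u))}" using ux gf by metis
      then show ?thesis using 1 by (intro image_eqI[of _ _ "f u"]) auto
    next
      case 2
      then have "e = {g (f x), g (Suc (f x))}" using ux gf by (metis insert_commute)
      then show ?thesis using 2 by (intro image_eqI[of _ _ "f x"]) auto
    qed
  qed
  then have "card E \<le> card {..<n - 1}" by (rule surj_card_le[rotated]) simp
  then show "card E \<le> n - 1" by simp
  fix v assume "v \<in> V"
  \<comment> \<open>At the ends of the path one listed set is spurious: \<open>f v - 1\<close> is 0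
    when \<open>f v = 0\<close>, and \<open>g n\<close> is unspecified. This is harmless for an
    upper bound.\<close>
  have "{e \<in> E. v \<in> e} \<subseteq> {{v, g (f v - 1)}, {v, g (Suc (f v))}}"
  proof
    fix e assume "e \<in> {e \<in> E. v \<in> e}"
    then have e: "e \<in> E" "v \<in> e" by auto
    obtain x where x: "e = {v, x}" "x \<in> V"
      using simple_graph_incident_edge[OF assms(1) e] .
    then have "x = g (f v - 1) \<or> x = g (Suc (f v))"
      using step[of v x] e gf[of x] by auto
    then show "e \<in> {{v, g (f v - 1)}, {v, g (Suc (f v))}}" using x by auto
  qed
  then have "degree E v \<le> card {{v, g (f v - 1)}, {v, g (Suc (f v))}}"
    unfolding degree_def by (intro card_mono) auto
  also have "\<dots> \<le> 2" using card_insert_le_m1[of 2 "{{v, g (Suc (f v))}}"] by simp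
  finally show "degree E v \<le> 2" .
qed

section \<open>Summation over all edges and the equality case\<close>

theorem corollary2p9:
  fixes V :: "'a set" and E :: "'a set set" and n k :: nat
  assumes "3 \<le> n" and "1 \<le> k" and "k \<le> n - 1"
    and "simple_graph V E" and "connected_graph V E" and "card V = n"
    and "edge_connectivity V E \<le> k"
  shows "sombor_index E \<ge> 2 * sqrt 2 * (real n - 3) + 2 * sqrt 5
    \<and> (sombor_index E = 2 * sqrt 2 * (real n - 3) + 2 * sqrt 5
        \<longleftrightarrow> graph_iso V E (path_verts n) (path_edges n))"
proof -
  note sg = assms(4) and conn = assms(5) and n = assms(1) and cV = assms(6)
  have finE: "finite E" using simple_graph_finite_edges[OF sg] .
  define F where "F e = sqrt (\<Sum>v\<in>e. (real (degree E v))\<^sup>2)" for e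
  define G where "G e = 2 * path_slope + (\<Sum>v\<in>e. path_defect / real (degree E v))" for e
  have edge: "G e \<le> F e \<and> (F e = G e \<longleftrightarrow> (\<forall>v\<in>e. degree E v \<le> 2))" if eE: "e \<in> E" for e
  proof -
    obtain u v where uv: "e = {u, v}" "u \<noteq> v" "u \<in> V" "v \<in> V"
      using simple_graph_edge[OF sg eE] .
    have pos: "1 \<le> degree E u" "1 \<le> degree E v"
      using connected_graph_degree_pos[OF sg conn] uv n cV by auto
    \<comment> \<open>This is where \<open>3 \<le> n\<close> matters: for n = 2 the only edge joins
      two leaves, and SO(P_2) = sqrt 2 is below 2 sqrt 5 - 2 sqrt 2.\<close>
    have nl: "\<not> (degree E u = 1 \<and> degree E v = 1)"
      using connected_graph_no_leaf_edge[OF sg conn] eE uv n cV by auto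
    show ?thesis
      using sqrt_sum_squares_bound[OF pos nl] uv by (simp add: F_def G_def add.assoc)
  qed
  have "(\<Sum>e\<in>E. \<Sum>v\<in>e. path_defect / real (degree E v))
      = (\<Sum>v\<in>V. real (degree E v) * (path_defect / real (degree E v)))"
    using sum_over_edge_ends[OF sg] .
  \<comment> \<open>The degree cancels because it is positive; an isolated vertex would contribute
    0, as division by 0 yields 0.\<close>
  also have "\<dots> = (\<Sum>v\<in>V. path_defect)"
    using connected_graph_degree_pos[OF sg conn] n cV by (intro sum.cong) fastforce+
  finally have "(\<Sum>e\<in>E. G e) = 2 * path_slope * real (card E) + path_defect * real n"
    by (simp add: G_def sum.distrib cV)
  moreover have "sombor_index E = (\<Sum>e\<in>E. F e)" by (simp add: sombor_index_def F_def)
  moreover have "2 * path_slope * (real n - 1) + path_defect * real n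
      = 2 * sqrt 2 * (real n - 3) + 2 * sqrt 5"
    by (simp add: path_slope_def path_defect_def algebra_simps)
  \<comment> \<open>The excess over the bound is the total slack of the edges plus 2\<alpha> for
    each edge beyond n - 1. Both parts are nonnegative, so equality means that both vanish.\<close>
  ultimately have split: "sombor_index E - (2 * sqrt 2 * (real n - 3) + 2 * sqrt 5)
      = (\<Sum>e\<in>E. F e - G e) + 2 * path_slope * (real (card E) - (real n - 1))"
    by (simp add: sum_subtractf algebra_simps)
  have m: "n \<le> card E + 1" using connected_graph_card_edges[OF sg conn] cV by simp
  have nonneg: "0 \<le> (\<Sum>e\<in>E. F e - G e)" "0 \<le> 2 * path_slope * (real (card E) - (real n - 1))"
    using edge m path_slope_pos by (auto intro!: sum_nonneg)
  have "sombor_index E = 2 * sqrt 2 * (real n - 3) + 2 * sqrt 5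
      \<longleftrightarrow> (\<Sum>e\<in>E. F e - G e) = 0 \<and> 2 * path_slope * (real (card E) - (real n - 1)) = 0"
    using split nonneg by linarith
  also have "\<dots> \<longleftrightarrow> (\<forall>e\<in>E. \<forall>v\<in>e. degree E v \<le> 2) \<and> n = card E + 1"
    using sum_nonneg_eq_0_iff[OF finE, of "\<lambda>e. F e - G e"] edge path_slope_pos by auto
  \<comment> \<open>The edge ends are all of \<open>V\<close>, since no vertex is isolated.\<close>
  also have "\<dots> \<longleftrightarrow> (\<forall>v\<in>V. degree E v \<le> 2) \<and> n = card E + 1"
  proof -
    have "\<exists>e\<in>E. v \<in> e" if "v \<in> V" for v
    proof -
      have "degree E v \<noteq> 0" using connected_graph_degree_pos[OF sg conn _ that] n cV by simp
      then have "{e \<in> E. v \<in> e} \<noteq> {}" by (auto simp only: degree_def card.empty)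
      then show ?thesis by blast
    qed
    moreover have "v \<in> V" if "e \<in> E" "v \<in> e" for e v
      using sg that by (auto simp: simple_graph_def)
    ultimately show ?thesis by blast
  qed
  also have "\<dots> \<longleftrightarrow> graph_iso V E (path_verts n) (path_edges n)"
  proof
    assume "(\<forall>v\<in>V. degree E v \<le> 2) \<and> n = card E + 1"
    then show "graph_iso V E (path_verts n) (path_edges n)"
      using tree_max_degree_2_iso_path[OF sg conn] cV by auto
  next
    assume "graph_iso V E (path_verts n) (path_edges n)"
    from iso_path_card_edges_and_degree[OF sg this]
    \<comment> \<open>The isomorphism gives at most n - 1 edges, and \<open>m\<close> gives at least
      that many.\<close>
    show "(\<forall>v\<in>V. degree E v \<le> 2) \<and> n = card E + 1" using m n by auto
  qed
  finally show ?thesis using split nonneg by linarith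
qed

end
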